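(* Let $k,N\in\mathbb{N}$ and let $\mathcal{F}$ be a nonempty collection of $k$-colourings of $E(K_N)$. For any $\varepsilon>0$ there exist constants $C_0,n_0>0$, depending only on $(\varepsilon,k,N)$, such that for every $n\ge n_0$ there exists a collection $\mathcal{T}_n$ of $k$-colouring templates for $K_n$ satisfying: (i) $\mathcal{T}_n$ is a container family for $\mathrm{Forb}(\mathcal{F})_n$, i.e. for every template $t$ of $K_n$ with $\langle t\rangle\subseteq \mathrm{Forb}(\mathcal{F})_n$ there exists $t'\in\mathcal{T}_n$ with $t(e)\subseteq t'(e)$ for every $e\in E(K_n)$; (ii) for each $t\in\mathcal{T}_n$ there are at most $\varepsilon\binom{n}{N}$ pairs $(\phi,c)$ with $\phi\in\binom{K_n}{K_N}$, $c\in\mathcal{F}$ and $c\in\langle t_{|\phi}\rangle$; (iii) $\log_k|\mathcal{T}_n|\le \dfrac{C_0}{n^{1/(2\binom{N}{2}-1)}}\binom{n}{2}$.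
   Context: $K_n$ is the complete graph on $[n]=\{1,\dots,n\}$, with $E(K_n)=[n]^{(2)}$. A $k$-colouring of $K_n$ is a map $c:E(K_n)\to[k]$. For $m\le n$, $\binom{K_n}{K_m}$ denotes the set of order-preserving injections $\phi:[m]\to[n]$; for a $k$-colouring $c$ of $K_n$, $c_{|\phi}$ is the $k$-colouring of $K_m$ given by $c_{|\phi}(ij)=c(\phi(i)\phi(j))$. A ($k$-colouring) template for $K_n$ is a map $t:E(K_n)\to 2^{[k]}\setminus\{\emptyset\}$; $t_{|\phi}$ is defined by $t_{|\phi}(ij)=t(\phi(i)\phi(j))$; $\langle t\rangle$ is the set of $k$-colourings $c$ with $c(e)\in t(e)$ for all $e$. For a family $\mathcal{F}$ of $k$-colourings of $K_N$, $\mathrm{Forb}(\mathcal{F})_n$ is the set of $k$-colourings $c$ of $K_n$ such that $c_{|\phi}\notin\mathcal{F}$ for all $\phi\in\binom{K_n}{K_N}$. *)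

theory Defs
  imports Complex_Main "HOL-Library.FuncSet"
begin

definition K_edges :: "nat \<Rightarrow> nat set set" where
  "K_edges n = {e. e \<subseteq> {1..n} \<and> card e = 2}"

text \<open>
  All maps below live in extensional function spaces, so that each map on its finite domain
  is represented by exactly one HOL function; in particular the sets of colourings, templates
  and injections are finite and cardinalities are the intended ones.
\<close>

definition colourings :: "nat \<Rightarrow> nat \<Rightarrow> (nat set \<Rightarrow> nat) set" where
  "colourings k n = K_edges n \<rightarrow>\<^sub>E {1..k}"

definition templates :: "nat \<Rightarrow> nat \<Rightarrow> (nat set \<Rightarrow> nat set) set" where
  "templates k n = K_edges n \<rightarrow>\<^sub>E (Pow {1..k} - {{}})"

definition order_embeddings :: "nat \<Rightarrow> nat \<Rightarrow> (nat \<Rightarrow> nat) set" where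
  "order_embeddings m n =
     {\<phi> \<in> {1..m} \<rightarrow>\<^sub>E {1..n}. inj_on \<phi> {1..m} \<and> mono_on {1..m} \<phi>}"

text \<open>
  Restriction along an injection of \<open>[m]\<close>, for colourings and templates alike: the edge
  \<open>ij\<close> is sent to the value at the edge \<open>\<phi>(i)\<phi>(j)\<close>.
\<close>

definition restr :: "nat \<Rightarrow> (nat set \<Rightarrow> 'a) \<Rightarrow> (nat \<Rightarrow> nat) \<Rightarrow> (nat set \<Rightarrow> 'a)" where
  "restr m f \<phi> = (\<lambda>e\<in>K_edges m. f (\<phi> ` e))"

definition realisations :: "nat \<Rightarrow> nat \<Rightarrow> (nat set \<Rightarrow> nat set) \<Rightarrow> (nat set \<Rightarrow> nat) set" where
  "realisations k n t = {c \<in> colourings k n. \<forall>e\<in>K_edges n. c e \<in> t e}"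

definition Forb :: "nat \<Rightarrow> nat \<Rightarrow> (nat set \<Rightarrow> nat) set \<Rightarrow> nat \<Rightarrow> (nat set \<Rightarrow> nat) set" where
  "Forb k N F n = {c \<in> colourings k n. \<forall>\<phi>\<in>order_embeddings N n. restr N c \<phi> \<notin> F}"

definition container_family ::
  "nat \<Rightarrow> nat \<Rightarrow> (nat set \<Rightarrow> nat) set \<Rightarrow> (nat set \<Rightarrow> nat set) set \<Rightarrow> bool" where
  "container_family k n P T \<longleftrightarrow>
     (\<forall>t\<in>templates k n. realisations k n t \<subseteq> P \<longrightarrow>
        (\<exists>t'\<in>T. \<forall>e\<in>K_edges n. t e \<subseteq> t' e))"

end

theory Submission
  imports Defs
begin

text \<open>
  A template \<open>t\<close> is a set of pairs \<open>(e, a)\<close> with \<open>a \<in> t e\<close>. It has all its realisations in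
  \<open>Forb\<close> iff this set is independent in the hypergraph whose edges are the coloured copies
  \<open>(\<phi>, c)\<close> with \<open>c \<in> F\<close>. This hypergraph is \<open>N choose 2\<close>-uniform, lives on about \<open>n\<^sup>2\<close>
  vertices, has degrees of order \<open>n ^ (N - 2)\<close>, and its codegrees are smaller by a factor \<open>n\<close>,
  because two distinct edges of \<open>K\<^sub>n\<close> span at least three vertices.

  For such hypergraphs a container algorithm in the style of Kleitman and Winston lowers the
  uniformity \<open>s\<close> one step at a time; only the codegree of pairs is needed. Each run omits a
  constant proportion of the vertices as long as many edges are left, at the cost of \<open>q\<close> choices
  of vertices per level, where \<open>q\<close> is about \<open>n powr (2 - 1 / s)\<close>. Boundedly many runs leave few
  edges, and since \<open>1 / s > 1 / (2 * s - 1)\<close> for \<open>s > 1\<close>, the factor \<open>log n\<close> in the count is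
  absorbed (for \<open>s = 1\<close> no choices are made).
\<close>

subsection \<open>Covering families\<close>

definition coverable :: "('a set \<Rightarrow> bool) \<Rightarrow> nat \<Rightarrow> 'a set set \<Rightarrow> bool" where
  "coverable good b \<I> \<longleftrightarrow>
     (\<exists>\<C>. finite \<C> \<and> card \<C> \<le> b \<and> (\<forall>C\<in>\<C>. good C) \<and> (\<forall>I\<in>\<I>. \<exists>C\<in>\<C>. I \<subseteq> C))"

lemma coverableI:
  assumes "finite \<C>" "card \<C> \<le> b" "\<And>C. C \<in> \<C> \<Longrightarrow> good C"
    "\<And>I. I \<in> \<I> \<Longrightarrow> \<exists>C\<in>\<C>. I \<subseteq> C"
  shows "coverable good b \<I>"
  unfolding coverable_def by (rule exI[of _ \<C>]) (simp add: assms)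

lemma coverableE:
  assumes "coverable good b \<I>"
  obtains \<C> where "finite \<C>" "card \<C> \<le> b" "\<And>C. C \<in> \<C> \<Longrightarrow> good C"
    "\<And>I. I \<in> \<I> \<Longrightarrow> \<exists>C\<in>\<C>. I \<subseteq> C"
proof -
  from assms obtain \<C> where "finite \<C> \<and> card \<C> \<le> b \<and> (\<forall>C\<in>\<C>. good C) \<and> (\<forall>I\<in>\<I>. \<exists>C\<in>\<C>. I \<subseteq> C)"
    unfolding coverable_def ..
  then show thesis by (intro that[of \<C>]) simp_all
qed

lemma coverable_mono:
  assumes "coverable good b \<I>" "\<I>' \<subseteq> \<I>" "b \<le> b'" "\<And>C. good C \<Longrightarrow> good' C"
  shows "coverable good' b' \<I>'"
proof -
  obtain \<C> where "finite \<C>" "card \<C> \<le> b" "\<And>C. C \<in> \<C> \<Longrightarrow> good C"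
    "\<And>I. I \<in> \<I> \<Longrightarrow> \<exists>C\<in>\<C>. I \<subseteq> C"
    using coverableE[OF assms(1)] by metis
  with assms(2-4) show ?thesis by (intro coverableI[of \<C>]) auto
qed

lemma coverable_singleton:
  assumes "good C" "\<And>I. I \<in> \<I> \<Longrightarrow> I \<subseteq> C" "1 \<le> b"
  shows "coverable good b \<I>"
  by (rule coverableI[of "{C}"]) (use assms in auto)

lemma coverable_Un:
  assumes "coverable good b \<I>" "coverable good b' \<I>'"
  shows "coverable good (b + b') (\<I> \<union> \<I>')"
proof -
  obtain \<C> where \<C>: "finite \<C>" "card \<C> \<le> b" "\<And>C. C \<in> \<C> \<Longrightarrow> good C"
    "\<And>I. I \<in> \<I> \<Longrightarrow> \<exists>C\<in>\<C>. I \<subseteq> C"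
    using coverableE[OF assms(1)] by metis
  obtain \<C>' where \<C>': "finite \<C>'" "card \<C>' \<le> b'" "\<And>C. C \<in> \<C>' \<Longrightarrow> good C"
    "\<And>I. I \<in> \<I>' \<Longrightarrow> \<exists>C\<in>\<C>'. I \<subseteq> C"
    using coverableE[OF assms(2)] by metis
  show ?thesis
  proof (rule coverableI[of "\<C> \<union> \<C>'"])
    show "card (\<C> \<union> \<C>') \<le> b + b'"
      using card_Un_le[of \<C> \<C>'] \<C>(2) \<C>'(2) by linarith
    show "\<exists>C\<in>\<C> \<union> \<C>'. I \<subseteq> C" if "I \<in> \<I> \<union> \<I>'" for I
      using that \<C>(4) \<C>'(4) by blast
  qed (use \<C>(1,3) \<C>'(1,3) in auto)
qed

lemma coverable_trans:
  assumes cover: "coverable good b \<I>"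
    and refine: "\<And>C. good C \<Longrightarrow> coverable good' b' (\<I> \<inter> Pow C)"
  shows "coverable good' (b * b') \<I>"
proof -
  obtain \<C> where \<C>: "finite \<C>" "card \<C> \<le> b" "\<And>C. C \<in> \<C> \<Longrightarrow> good C"
    "\<And>I. I \<in> \<I> \<Longrightarrow> \<exists>C\<in>\<C>. I \<subseteq> C"
    using coverableE[OF cover] by metis
  have "\<forall>C\<in>\<C>. \<exists>\<D>. finite \<D> \<and> card \<D> \<le> b' \<and> (\<forall>D\<in>\<D>. good' D) \<and>
      (\<forall>I\<in>\<I> \<inter> Pow C. \<exists>D\<in>\<D>. I \<subseteq> D)"
    using refine[OF \<C>(3)] unfolding coverable_def by simp
  then obtain \<D> where \<D>: "\<forall>C\<in>\<C>. finite (\<D> C) \<and> card (\<D> C) \<le> b' \<and> (\<forall>D\<in>\<D> C. good' D) \<and>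
      (\<forall>I\<in>\<I> \<inter> Pow C. \<exists>D\<in>\<D> C. I \<subseteq> D)"
    by (elim bchoice[elim_format] exE)
  show ?thesis
  proof (rule coverableI[of "\<Union>C\<in>\<C>. \<D> C"])
    have "card (\<Union>C\<in>\<C>. \<D> C) \<le> (\<Sum>C\<in>\<C>. card (\<D> C))"
      using \<C>(1) by (rule card_UN_le)
    also have "\<dots> \<le> card \<C> * b'"
      using sum_bounded_above[of \<C> "\<lambda>C. card (\<D> C)" b'] \<D> by simp
    also have "\<dots> \<le> b * b'" using \<C>(2) by simp
    finally show "card (\<Union>C\<in>\<C>. \<D> C) \<le> b * b'" .
    show "\<exists>D\<in>\<Union>C\<in>\<C>. \<D> C. I \<subseteq> D" if I: "I \<in> \<I>" for I
    proof -
      obtain C where "C \<in> \<C>" "I \<subseteq> C" using \<C>(4)[OF I] by blast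
      then show ?thesis using \<D> I by (metis IntI PowI UN_I)
    qed
  qed (use \<C>(1) \<D> in auto)
qed

definition omits :: "real \<Rightarrow> 'a set \<Rightarrow> 'a set \<Rightarrow> bool" where
  "omits G V C \<longleftrightarrow> C \<subseteq> V \<and> G \<le> card (V - C)"

lemma omits_card:
  fixes G :: real
  assumes "finite V" "omits G V C"
  shows "card C + G \<le> card V"
proof -
  have "card V = card C + card (V - C)"
    using assms unfolding omits_def
    by (metis Diff_partition Diff_disjoint card_Un_disjoint finite_Diff finite_subset)
  then show ?thesis using assms by (simp add: omits_def)
qed

lemma coverable_iterate:
  fixes G :: real
  assumes finV: "finite V" and b: "1 \<le> b" and empty: "good {}"
    and shrink: "\<And>W. W \<subseteq> V \<Longrightarrow> \<not> good W \<Longrightarrow> coverable (omits G W) b (\<I> \<inter> Pow W)"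
    and "W \<subseteq> V" "card W \<le> i * G"
  shows "coverable (\<lambda>C. C \<subseteq> V \<and> good C) (b ^ i) (\<I> \<inter> Pow W)"
  using assms(5,6)
proof (induction i arbitrary: W)
  case 0
  then have "W = {}" using finV by (simp add: finite_subset)
  then show ?case using empty by (intro coverable_singleton[of _ "{}"]) auto
next
  case (Suc i)
  show ?case
  proof (cases "good W")
    case True
    then show ?thesis using Suc.prems b by (intro coverable_singleton[of _ W]) auto
  next
    case False
    have "coverable (\<lambda>C. C \<subseteq> V \<and> good C) (b * b ^ i) (\<I> \<inter> Pow W)"
    proof (rule coverable_trans)
      show "coverable (omits G W) b (\<I> \<inter> Pow W)" using Suc.prems(1) False by (rule shrink)
      fix C assume C: "omits G W C"
      have "finite W" using Suc.prems(1) finV by (rule finite_subset)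
      then have "card C + G \<le> card W" using C by (rule omits_card)
      then have "card C \<le> i * G" using Suc.prems(2) by (simp add: algebra_simps)
      moreover have "C \<subseteq> V" using C Suc.prems(1) by (auto simp: omits_def)
      ultimately have "coverable (\<lambda>C. C \<subseteq> V \<and> good C) (b ^ i) (\<I> \<inter> Pow C)"
        by (intro Suc.IH)
      then show "coverable (\<lambda>C. C \<subseteq> V \<and> good C) (b ^ i) (\<I> \<inter> Pow W \<inter> Pow C)"
        by (rule coverable_mono) auto
    qed
    then show ?thesis by simp
  qed
qed

subsection \<open>Hypergraphs with bounded degrees and codegrees\<close>

definition degree :: "('j \<Rightarrow> 'a set) \<Rightarrow> 'j set \<Rightarrow> 'a \<Rightarrow> nat" where
  "degree g J x = card {j \<in> J. x \<in> g j}"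

definition codegree :: "('j \<Rightarrow> 'a set) \<Rightarrow> 'j set \<Rightarrow> 'a \<Rightarrow> 'a \<Rightarrow> nat" where
  "codegree g J x y = card {j \<in> J. x \<in> g j \<and> y \<in> g j}"

definition induced_edges :: "('j \<Rightarrow> 'a set) \<Rightarrow> 'j set \<Rightarrow> 'a set \<Rightarrow> 'j set" where
  "induced_edges g J W = {j \<in> J. g j \<subseteq> W}"

definition independent_sets :: "'a set \<Rightarrow> ('j \<Rightarrow> 'a set) \<Rightarrow> 'j set \<Rightarrow> 'a set set" where
  "independent_sets V g J = {I. I \<subseteq> V \<and> induced_edges g J I = {}}"

lemma degree_mono:
  assumes "finite J" "J' \<subseteq> J" "\<And>j. j \<in> J' \<Longrightarrow> h j \<subseteq> g j"
  shows "degree h J' x \<le> degree g J x"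
  unfolding degree_def by (rule card_mono) (use assms in auto)

lemma codegree_mono:
  assumes "finite J" "J' \<subseteq> J" "\<And>j. j \<in> J' \<Longrightarrow> h j \<subseteq> g j"
  shows "codegree h J' x y \<le> codegree g J x y"
  unfolding codegree_def by (rule card_mono) (use assms in auto)

lemma card_edges_meeting_le:
  fixes D :: real
  assumes "finite J" "finite B" "\<And>x. x \<in> B \<Longrightarrow> degree g J x \<le> D"
    and "\<And>j. j \<in> J \<Longrightarrow> g j \<inter> B \<noteq> {}"
  shows "card J \<le> D * card B"
proof -
  have "card J \<le> card (\<Union>x\<in>B. {j \<in> J. x \<in> g j})"
    by (rule card_mono) (use assms in auto)
  also have "\<dots> \<le> (\<Sum>x\<in>B. degree g J x)"
    unfolding degree_def using assms(2) by (rule card_UN_le)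
  finally have "real (card J) \<le> (\<Sum>x\<in>B. real (degree g J x))"
    by (metis of_nat_le_iff of_nat_sum)
  also have "\<dots> \<le> D * card B"
    using sum_bounded_above[of B "\<lambda>x. real (degree g J x)" D] assms(3) by (simp add: mult.commute)
  finally show ?thesis .
qed

lemma card_high_degree_le:
  fixes \<Delta> :: real
  assumes "finite V" "finite J" "\<And>j. j \<in> J \<Longrightarrow> g j \<subseteq> V \<and> card (g j) = r"
  shows "\<Delta> * card {x \<in> V. \<Delta> \<le> degree g J x} \<le> r * card J"
proof -
  have "\<Delta> * card {x \<in> V. \<Delta> \<le> degree g J x} \<le> (\<Sum>x | x \<in> V \<and> \<Delta> \<le> degree g J x. real (degree g J x))"
    using sum_bounded_below[of "{x \<in> V. \<Delta> \<le> degree g J x}" \<Delta> "\<lambda>x. real (degree g J x)"]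
    by (simp add: mult.commute)
  also have "\<dots> \<le> (\<Sum>x\<in>V. real (degree g J x))"
    using assms(1) by (intro sum_mono2) auto
  also have "(\<Sum>x\<in>V. degree g J x) = r * card J"
    unfolding degree_def
  proof (rule sum_multicount[OF assms(1,2)], intro ballI)
    fix j assume "j \<in> J"
    then have "{x \<in> V. x \<in> g j} = g j" using assms(3) by auto
    then show "card {x \<in> V. x \<in> g j} = r" using assms(3) \<open>j \<in> J\<close> by simp
  qed
  then have "(\<Sum>x\<in>V. real (degree g J x)) = r * card J" by (metis of_nat_mult of_nat_sum)
  finally show ?thesis .
qed

locale bounded_hypergraph =
  fixes V :: "'a set" and J :: "'j set" and g :: "'j \<Rightarrow> 'a set" and r :: nat and D K :: real
  assumes finite_vertices: "finite V" and finite_edges: "finite J"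
    and edge_subset: "j \<in> J \<Longrightarrow> g j \<subseteq> V" and card_edge: "j \<in> J \<Longrightarrow> card (g j) = r"
    and degree_le: "degree g J x \<le> D" and codegree_le: "x \<noteq> y \<Longrightarrow> codegree g J x y \<le> K"
    and D_pos: "0 < D" and K_nonneg: "0 \<le> K"
begin

lemma shorten_edges:
  fixes D' :: real
  assumes "W \<subseteq> V" "J' \<subseteq> J" "\<And>j. j \<in> J' \<Longrightarrow> h j \<subseteq> g j \<inter> W" "\<And>j. j \<in> J' \<Longrightarrow> card (h j) = s"
    and "\<And>x. degree h J' x \<le> D'" "0 < D'"
  shows "bounded_hypergraph W J' h s D' K"
proof
  show "codegree h J' x y \<le> K" if "x \<noteq> y" for x y
    using codegree_mono[of J J' h g x y] codegree_le[OF that] finite_edges assms(2,3) by fastforce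
qed (use assms finite_vertices finite_edges K_nonneg in \<open>auto intro: finite_subset\<close>)

lemma restrict_vertices:
  assumes "W \<subseteq> V"
  shows "bounded_hypergraph W (induced_edges g J W) g r D K"
proof (rule shorten_edges)
  show "W \<subseteq> V" by fact
  show "degree g (induced_edges g J W) x \<le> D" for x
    using degree_mono[of J "induced_edges g J W" g g x] degree_le[of x] finite_edges
    by (simp add: induced_edges_def)
qed (use card_edge D_pos in \<open>auto simp: induced_edges_def\<close>)

lemma card_edges_le:
  assumes "0 < r"
  shows "card J \<le> D * card V"
proof (rule card_edges_meeting_le[OF finite_edges finite_vertices degree_le])
  fix j assume "j \<in> J"
  then show "g j \<inter> V \<noteq> {}"
    using edge_subset card_edge assms by (metis card.empty inf.absorb1 less_irrefl)
qed

lemma coverable_singleton_edges: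
  fixes G :: real
  assumes "r = 1" "D * G \<le> card J" "1 \<le> b"
  shows "coverable (omits G V) b (independent_sets V g J)"
proof (rule coverable_singleton[of _ "V - \<Union>(g ` J)"])
  have union: "\<Union>(g ` J) \<subseteq> V" using edge_subset by auto
  then have "card J \<le> D * card (\<Union>(g ` J))"
  proof (intro card_edges_meeting_le[where g=g, OF finite_edges _ degree_le])
    show "g j \<inter> \<Union>(g ` J) \<noteq> {}" if "j \<in> J" for j
    proof -
      have "g j \<noteq> {}" using card_edge[OF that] assms(1) by auto
      then show ?thesis using that by auto
    qed
  qed (use finite_vertices finite_subset in auto)
  with assms(2) have "D * G \<le> D * card (\<Union>(g ` J))" by linarith
  then have "G \<le> card (\<Union>(g ` J))" using D_pos by simp
  moreover have "V - (V - \<Union>(g ` J)) = \<Union>(g ` J)" using union by blast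
  ultimately show "omits G V (V - \<Union>(g ` J))" by (simp add: omits_def)
next
  fix I assume I: "I \<in> independent_sets V g J"
  have "x \<notin> I" if j: "j \<in> J" and x: "x \<in> g j" for x j
  proof -
    have "g j = {x}" using card_edge[OF j] assms(1) x by (metis card_1_singletonE singletonD)
    then show ?thesis using I j by (auto simp: independent_sets_def induced_edges_def)
  qed
  then show "I \<subseteq> V - \<Union>(g ` J)" using I by (auto simp: independent_sets_def)
qed fact

end

subsection \<open>One pass of the container algorithm\<close>

lemma power_add_pred_le:
  fixes a t :: nat
  assumes "0 < t"
  shows "a ^ t + a ^ (t - 1) \<le> (a + 1) ^ t"
proof -
  obtain u where t: "t = Suc u" using assms gr0_conv_Suc by auto
  have "a ^ t + a ^ (t - 1) = (a + 1) * a ^ u" by (simp add: t)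
  also have "\<dots> \<le> (a + 1) * (a + 1) ^ u" by (intro mult_le_mono2 power_mono) auto
  finally show ?thesis by (simp add: t)
qed

text \<open>
  The scan maintains a set \<open>A\<close> of unscanned vertices, a set \<open>S\<close> of selected vertices, and a set \<open>Q\<close>
  of edges that have been shortened from \<open>g\<close> to \<open>h\<close> by removing a selected vertex. A vertex of high
  degree among the live edges is scanned next: it is either discarded or selected, and in the
  latter case the live edges through it are moved to \<open>Q\<close>. Saturated vertices make their edges
  cease to be live, so that the degrees in \<open>Q\<close> stay bounded. As the decision tree itself is
  counted, no explicit fingerprints are needed.
\<close>

locale vertex_scan = bounded_hypergraph V J g "Suc r" D K
  for V :: "'a set" and J :: "'j set" and g and r and D K :: real +
  fixes \<Delta> \<tau> G :: real and q :: nat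
  assumes \<Delta>_pos: "0 < \<Delta>" and \<tau>_pos: "0 < \<tau>"
    and many_edges: "\<tau> * card V + D * (q + r * (D * q) / \<Delta> + G) \<le> card J"
begin

definition saturated :: "('j \<Rightarrow> 'a set) \<Rightarrow> 'j set \<Rightarrow> 'a set" where
  "saturated h Q = {x \<in> V. \<Delta> \<le> degree h Q x}"

definition live_edges :: "'a set \<Rightarrow> ('j \<Rightarrow> 'a set) \<Rightarrow> 'j set \<Rightarrow> 'j set" where
  "live_edges A h Q = induced_edges g J (A - saturated h Q)"

definition live_star :: "'a set \<Rightarrow> ('j \<Rightarrow> 'a set) \<Rightarrow> 'j set \<Rightarrow> 'a \<Rightarrow> 'j set" where
  "live_star A h Q v = {j \<in> live_edges A h Q. v \<in> g j}"

definition shorten_star :: "'a set \<Rightarrow> ('j \<Rightarrow> 'a set) \<Rightarrow> 'j set \<Rightarrow> 'a \<Rightarrow> 'j \<Rightarrow> 'a set" where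
  "shorten_star A h Q v j = (if j \<in> live_star A h Q v then g j - {v} else h j)"

definition scan_state :: "'a set \<Rightarrow> 'a set \<Rightarrow> ('j \<Rightarrow> 'a set) \<Rightarrow> 'j set \<Rightarrow> bool" where
  "scan_state A S h Q \<longleftrightarrow> A \<subseteq> V \<and> S \<subseteq> V \<and> A \<inter> S = {} \<and> Q \<subseteq> J \<and>
     (\<forall>j\<in>Q. h j \<subseteq> g j \<and> card (h j) = r \<and> \<not> g j \<subseteq> A) \<and>
     (\<forall>x. degree h Q x \<le> \<Delta> + K) \<and> \<tau> * card S \<le> card Q \<and> card Q \<le> D * card S"

definition candidates :: "'a set \<Rightarrow> 'a set \<Rightarrow> ('j \<Rightarrow> 'a set) \<Rightarrow> 'j set \<Rightarrow> 'a set set" where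
  "candidates A S h Q = independent_sets V g J \<inter> independent_sets V h Q \<inter> Pow (A \<union> S)"

lemma scan_state_finite:
  assumes "scan_state A S h Q"
  shows "finite A" "finite S" "finite Q"
  using assms finite_vertices finite_edges by (auto simp: scan_state_def intro: finite_subset)

lemma finite_live_star: "finite (live_star A h Q v)"
  using finite_edges by (simp add: live_star_def live_edges_def induced_edges_def)

lemma candidates_subset:
  assumes "v \<in> A"
  shows "candidates A S h Q \<subseteq> candidates (A - {v}) S h Q \<union>
    candidates (A - {v}) (insert v S) (shorten_star A h Q v) (Q \<union> live_star A h Q v)"
proof
  fix I assume I: "I \<in> candidates A S h Q"
  show "I \<in> candidates (A - {v}) S h Q \<union>
    candidates (A - {v}) (insert v S) (shorten_star A h Q v) (Q \<union> live_star A h Q v)"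
  proof (cases "v \<in> I")
    case True
    have "\<not> shorten_star A h Q v j \<subseteq> I" if j: "j \<in> Q \<union> live_star A h Q v" for j
    proof (cases "j \<in> live_star A h Q v")
      case True
      then have "j \<in> J" by (simp add: live_star_def live_edges_def induced_edges_def)
      then have "\<not> g j \<subseteq> I"
        using I by (auto simp: candidates_def independent_sets_def induced_edges_def)
      then show ?thesis using True \<open>v \<in> I\<close> by (auto simp: shorten_star_def)
    next
      case False
      then show ?thesis
        using I j
        by (auto simp: candidates_def independent_sets_def induced_edges_def shorten_star_def)
    qed
    then show ?thesis
      using I by (auto simp: candidates_def independent_sets_def induced_edges_def)
  next
    case False
    then show ?thesis using I by (auto simp: candidates_def)
  qed
qed

lemma scan_state_discard:
  assumes "scan_state A S h Q"
  shows "scan_state (A - {v}) S h Q"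
  using assms unfolding scan_state_def by blast

lemma degree_shorten_star_le:
  assumes state: "scan_state A S h Q"
  shows "degree (shorten_star A h Q v) (Q \<union> live_star A h Q v) x \<le> \<Delta> + K"
proof -
  let ?N = "live_star A h Q v"
  have degree_h: "degree h Q x \<le> \<Delta> + K" using state by (simp add: scan_state_def)
  have subset: "{j \<in> Q \<union> ?N. x \<in> shorten_star A h Q v j}
      \<subseteq> {j \<in> Q. x \<in> h j} \<union> {j \<in> ?N. x \<in> g j - {v}}"
    by (auto simp: shorten_star_def)
  show ?thesis
  proof (cases "{j \<in> ?N. x \<in> g j - {v}} = {}")
    case True
    then have "degree (shorten_star A h Q v) (Q \<union> ?N) x \<le> degree h Q x"
      unfolding degree_def using subset scan_state_finite[OF state] by (intro card_mono) auto
    then show ?thesis using degree_h by linarith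
  next
    case False
    then obtain j where j: "j \<in> live_edges A h Q" "x \<in> g j" "x \<noteq> v" by (auto simp: live_star_def)
    then have "degree h Q x < \<Delta>"
      using state by (fastforce simp: live_edges_def induced_edges_def saturated_def scan_state_def)
    moreover have "card {j \<in> ?N. x \<in> g j - {v}} \<le> codegree g J x v"
      unfolding codegree_def using finite_edges
      by (intro card_mono) (auto simp: live_star_def live_edges_def induced_edges_def)
    then have "card {j \<in> ?N. x \<in> g j - {v}} \<le> K" using codegree_le[OF j(3)] by linarith
    moreover have "degree (shorten_star A h Q v) (Q \<union> ?N) x
        \<le> degree h Q x + card {j \<in> ?N. x \<in> g j - {v}}"
      unfolding degree_def
      using card_mono[OF _ subset] card_Un_le[of "{j \<in> Q. x \<in> h j}" "{j \<in> ?N. x \<in> g j - {v}}"]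
        scan_state_finite[OF state] finite_live_star[of A h Q v] by fastforce
    ultimately show ?thesis by linarith
  qed
qed

lemma scan_state_select:
  assumes state: "scan_state A S h Q" and v: "v \<in> A"
    and high_degree: "\<tau> \<le> degree g (live_edges A h Q) v"
  shows "scan_state (A - {v}) (insert v S) (shorten_star A h Q v) (Q \<union> live_star A h Q v)"
proof -
  let ?N = "live_star A h Q v"
  have N: "j \<in> J \<and> g j \<subseteq> A \<and> v \<in> g j" if "j \<in> ?N" for j
    using that by (auto simp: live_star_def live_edges_def induced_edges_def)
  have disjoint: "Q \<inter> ?N = {}" using state N by (force simp: scan_state_def)
  have "v \<notin> S" using state v by (auto simp: scan_state_def)
  then have "card (insert v S) = card S + 1" using scan_state_finite[OF state] by simp
  moreover have "card (Q \<union> ?N) = card Q + card ?N"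
    using disjoint scan_state_finite[OF state] finite_live_star by (intro card_Un_disjoint)
  moreover have "\<tau> \<le> card ?N" using high_degree by (simp add: degree_def live_star_def)
  moreover have "card ?N \<le> D"
    using degree_mono[of J "live_edges A h Q" g g v] degree_le[of v] finite_edges
    by (simp add: degree_def live_star_def live_edges_def induced_edges_def)
  ultimately have "\<tau> * card (insert v S) \<le> card (Q \<union> ?N)" "card (Q \<union> ?N) \<le> D * card (insert v S)"
    using state by (auto simp: scan_state_def algebra_simps)
  moreover have "shorten_star A h Q v j \<subseteq> g j \<and> card (shorten_star A h Q v j) = r \<and> \<not> g j \<subseteq> A - {v}"
    if "j \<in> Q \<union> ?N" for j
    using that state N[of j] card_edge[of j] by (auto simp: shorten_star_def scan_state_def)
  ultimately show ?thesis
    using state v N degree_shorten_star_le[OF state] by (auto simp: scan_state_def)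
qed

lemma card_live_edges_le:
  assumes "A \<subseteq> V" and low_degree: "\<And>v. v \<in> A \<Longrightarrow> degree g (live_edges A h Q) v < \<tau>"
  shows "card (live_edges A h Q) \<le> \<tau> * card V"
proof -
  have "card (live_edges A h Q) \<le> \<tau> * card A"
  proof (rule card_edges_meeting_le)
    show "g j \<inter> A \<noteq> {}" if "j \<in> live_edges A h Q" for j
    proof -
      have "g j \<subseteq> A" "g j \<noteq> {}"
        using that card_edge[of j] by (auto simp: live_edges_def induced_edges_def)
      then show ?thesis by blast
    qed
  qed (use assms finite_vertices finite_edges low_degree in
      \<open>auto simp: live_edges_def induced_edges_def less_imp_le intro: finite_subset\<close>)
  also have "\<dots> \<le> \<tau> * card V"
    using assms(1) finite_vertices \<tau>_pos by (intro mult_left_mono) (auto intro: card_mono)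
  finally show ?thesis .
qed

lemma card_dead_edges_le:
  assumes "A \<subseteq> V"
  shows "card (J - live_edges A h Q) \<le> D * (card (V - A) + card (saturated h Q))"
proof -
  have "card (J - live_edges A h Q) \<le> D * card ((V - A) \<union> saturated h Q)"
  proof (rule card_edges_meeting_le)
    show "degree g (J - live_edges A h Q) x \<le> D" for x
      using degree_mono[of J "J - live_edges A h Q" g g x] degree_le[of x] finite_edges by auto
    show "g j \<inter> (V - A \<union> saturated h Q) \<noteq> {}" if "j \<in> J - live_edges A h Q" for j
      using that edge_subset by (auto simp: live_edges_def induced_edges_def)
  qed (use finite_vertices finite_edges in \<open>auto simp: saturated_def\<close>)
  also have "\<dots> \<le> D * (card (V - A) + card (saturated h Q))"
    using D_pos by (intro mult_left_mono) (metis card_Un_le of_nat_add of_nat_le_iff, simp)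
  finally show ?thesis .
qed

lemma card_saturated_le:
  assumes state: "scan_state A S h Q" and "card S \<le> q"
  shows "card (saturated h Q) \<le> r * (D * q) / \<Delta>"
proof -
  have "h j \<subseteq> V \<and> card (h j) = r" if "j \<in> Q" for j
    using state that edge_subset by (fastforce simp: scan_state_def)
  then have "\<Delta> * card (saturated h Q) \<le> r * card Q"
    unfolding saturated_def
    using finite_vertices scan_state_finite(3)[OF state] by (intro card_high_degree_le)
  also have "\<dots> \<le> r * (D * card S)"
    using state by (simp add: scan_state_def mult_left_mono)
  also have "\<dots> \<le> r * (D * q)" using assms(2) D_pos by (intro mult_left_mono) auto
  finally show ?thesis using \<Delta>_pos by (simp add: field_simps)
qed

lemma omits_of_low_degree:
  assumes state: "scan_state A S h Q" and S: "card S \<le> q"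
    and low_degree: "\<And>v. v \<in> A \<Longrightarrow> degree g (live_edges A h Q) v < \<tau>"
  shows "omits G V (A \<union> S)"
proof -
  have A: "A \<subseteq> V" and "S \<subseteq> V" using state by (auto simp: scan_state_def)
  have "live_edges A h Q \<subseteq> J" by (auto simp: live_edges_def induced_edges_def)
  then have "card J = card (live_edges A h Q) + card (J - live_edges A h Q)"
    using finite_edges by (simp add: card_Diff_subset card_mono finite_subset)
  moreover note card_live_edges_le[OF A low_degree] card_dead_edges_le[OF A]
  ultimately have "card J \<le> \<tau> * card V + D * (card (V - A) + card (saturated h Q))"
    by (smt (verit) of_nat_add)
  also have "D * (card (V - A) + card (saturated h Q))
      \<le> D * (card (V - (A \<union> S)) + q + r * (D * q) / \<Delta>)"
  proof (rule mult_left_mono)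
    have "card (V - A) \<le> card ((V - (A \<union> S)) \<union> S)"
      using finite_vertices scan_state_finite[OF state] by (intro card_mono) auto
    also have "\<dots> \<le> card (V - (A \<union> S)) + card S" by (rule card_Un_le)
    finally show "card (V - A) + card (saturated h Q) \<le> card (V - (A \<union> S)) + q + r * (D * q) / \<Delta>"
      using card_saturated_le[OF state S] S by simp
  qed (use D_pos in simp)
  finally have "D * G \<le> D * card (V - (A \<union> S))" using many_edges by (simp add: algebra_simps)
  then show ?thesis using D_pos A \<open>S \<subseteq> V\<close> by (simp add: omits_def)
qed

lemma coverable_candidates:
  assumes shortened: "\<And>Q h. \<lbrakk>Q \<subseteq> J; \<And>j. j \<in> Q \<Longrightarrow> h j \<subseteq> g j \<and> card (h j) = r;
      \<And>x. degree h Q x \<le> \<Delta> + K; \<tau> * q \<le> card Q\<rbrakk> \<Longrightarrow> coverable (omits G V) b (independent_sets V h Q)"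
    and b: "0 < b"
    and "scan_state A S h Q" "card S \<le> q"
  shows "coverable (omits G V) (b * (card A + 1) ^ (q - card S)) (candidates A S h Q)"
  using assms(3,4)
proof (induction "card A" arbitrary: A S h Q rule: less_induct)
  case less
  note state = \<open>scan_state A S h Q\<close>
  consider "card S = q" | "\<forall>v\<in>A. degree g (live_edges A h Q) v < \<tau>"
    | v where "card S < q" "v \<in> A" "\<tau> \<le> degree g (live_edges A h Q) v"
    using less.prems(2) by force
  then show ?case
  proof cases
    case 1
    have "coverable (omits G V) b (independent_sets V h Q)"
      by (rule shortened) (use state 1 in \<open>auto simp: scan_state_def\<close>)
    then show ?thesis by (rule coverable_mono) (auto simp: 1 candidates_def)
  next
    case 2
    then have "omits G V (A \<union> S)" using state less.prems(2) by (intro omits_of_low_degree) auto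
    then show ?thesis
      by (rule coverable_singleton) (use b in \<open>auto simp: candidates_def Suc_le_eq\<close>)
  next
    case 3
    let ?a = "card (A - {v}) + 1" and ?t = "q - card S"
    have finA: "finite A" and finS: "finite S" using scan_state_finite[OF state] by auto
    have smaller: "card (A - {v}) < card A" using 3 finA by (metis card_Diff1_less)
    have "v \<notin> S" using state 3 by (auto simp: scan_state_def)
    then have S': "card (insert v S) \<le> q" "q - card (insert v S) = ?t - 1" using 3 finS by auto
    have discard: "coverable (omits G V) (b * ?a ^ ?t) (candidates (A - {v}) S h Q)"
      by (rule less.hyps[OF smaller scan_state_discard[OF state] less.prems(2)])
    have select: "coverable (omits G V) (b * ?a ^ (?t - 1))
        (candidates (A - {v}) (insert v S) (shorten_star A h Q v) (Q \<union> live_star A h Q v))"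
      using less.hyps[OF smaller scan_state_select[OF state 3(2,3)] S'(1)] by (simp only: S'(2))
    have "b * ?a ^ ?t + b * ?a ^ (?t - 1) \<le> b * (?a + 1) ^ ?t"
      unfolding distrib_left[symmetric] by (intro mult_le_mono2 power_add_pred_le) (use 3 in simp)
    then show ?thesis
      using coverable_mono[OF coverable_Un[OF discard select] candidates_subset[OF 3(2)]] smaller
        card_Suc_Diff1[OF finA 3(2)] by simp
  qed
qed

lemma coverable_independent_sets:
  assumes "\<And>Q h. \<lbrakk>Q \<subseteq> J; \<And>j. j \<in> Q \<Longrightarrow> h j \<subseteq> g j \<and> card (h j) = r;
      \<And>x. degree h Q x \<le> \<Delta> + K; \<tau> * q \<le> card Q\<rbrakk> \<Longrightarrow> coverable (omits G V) b (independent_sets V h Q)"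
    and "0 < b"
  shows "coverable (omits G V) (b * (card V + 1) ^ q) (independent_sets V g J)"
proof -
  have initial: "scan_state V {} g {}"
    using \<Delta>_pos K_nonneg by (simp add: scan_state_def degree_def)
  have "coverable (omits G V) (b * (card V + 1) ^ (q - card ({} :: 'a set))) (candidates V {} g {})"
    by (rule coverable_candidates[OF _ assms(2) initial]) (fact assms(1), simp)
  then have "coverable (omits G V) (b * (card V + 1) ^ q) (candidates V {} g {})" by simp
  then show ?thesis
    by (rule coverable_mono) (auto simp: candidates_def independent_sets_def induced_edges_def)
qed

end

subsection \<open>Containers for hypergraphs with small codegrees\<close>

fun shrink_rate :: "nat \<Rightarrow> real \<Rightarrow> real" where
  "shrink_rate 0 \<epsilon> = \<epsilon>"
| "shrink_rate (Suc r) \<epsilon> = min (\<epsilon> / 4) (shrink_rate r (\<epsilon>\<^sup>2 / (32 * real (Suc r))))"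

lemma shrink_rate_pos: "0 < \<epsilon> \<Longrightarrow> 0 < shrink_rate r \<epsilon>"
  by (induction r arbitrary: \<epsilon>) (simp_all add: add_pos_nonneg)

lemma density_le_one:
  fixes M \<epsilon> :: real
  assumes "bounded_hypergraph V J g (Suc r) D K" "card V \<le> M" "0 < M" "\<epsilon> * D * M \<le> card J"
  shows "\<epsilon> \<le> 1"
proof -
  interpret bounded_hypergraph V J g "Suc r" D K by fact
  have "\<epsilon> * (D * M) \<le> D * card V" using card_edges_le assms(4) by (simp add: mult_ac)
  also have "\<dots> \<le> D * M" using assms(2) D_pos by simp
  finally show ?thesis using D_pos assms(3) by simp
qed

text \<open>
  A quarter of the \<open>\<epsilon> * D * M\<close> edges is reserved for each of four losses: edges that stay live, and
  edges through selected, saturated and discarded vertices.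
\<close>

lemma vertex_scan_of_dense:
  fixes M \<epsilon> G :: real
  assumes "bounded_hypergraph V J g (Suc r) D K" "0 < r" "card V \<le> M" "0 < M" "0 < \<epsilon>"
    and "\<epsilon> * D * M \<le> card J" "0 < q" "q \<le> \<epsilon> / 4 * M" "G \<le> \<epsilon> / 4 * M"
  shows "vertex_scan V J g r D K (4 * r * (q / M * D) / \<epsilon>) (\<epsilon> * D / 4) G q"
proof -
  interpret bounded_hypergraph V J g "Suc r" D K by fact
  define \<Delta> where "\<Delta> = 4 * r * (q / M * D) / \<epsilon>"
  have saturation: "r * (D * q) / \<Delta> = \<epsilon> / 4 * M"
    using assms D_pos by (simp add: \<Delta>_def field_simps)
  have "\<epsilon> * D / 4 * card V + D * (q + r * (D * q) / \<Delta> + G)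
      \<le> \<epsilon> * D / 4 * M + D * (\<epsilon> / 4 * M + \<epsilon> / 4 * M + \<epsilon> / 4 * M)"
    unfolding saturation using assms D_pos by (intro add_mono mult_left_mono) auto
  also have "\<dots> = \<epsilon> * D * M" by (simp add: field_simps)
  also have "\<dots> \<le> card J" by fact
  finally show ?thesis
    using assms D_pos unfolding \<Delta>_def by unfold_locales auto
qed

text \<open>
  Shortening edges never increases the codegree bound \<open>K\<close>, while it multiplies the degree scale \<open>D\<close>
  by about \<open>q / M\<close>. This is why \<open>K \<le> (q / M) ^ r * D\<close> suffices for all \<open>r\<close> passes.
\<close>

lemma shortened_degree_bounds:
  fixes D K M \<epsilon> :: real and q :: nat
  assumes "0 < D" "0 \<le> K" "K \<le> (q / M) ^ Suc r * D" "0 < M" "0 < q" "q \<le> M" "0 < \<epsilon>" "\<epsilon> \<le> 1"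
  defines "\<Delta> \<equiv> 4 * real (Suc r) * (q / M * D) / \<epsilon>"
  shows "K \<le> (q / M) ^ r * (\<Delta> + K)"
    and "\<epsilon>\<^sup>2 / (32 * real (Suc r)) * (\<Delta> + K) * M \<le> \<epsilon> * D / 4 * q"
proof -
  define p where "p = q / M"
  have p: "0 < p" "p \<le> 1" "q = p * M" using assms by (simp_all add: p_def)
  have "1 \<le> 4 * real (Suc r) / \<epsilon>" using assms by simp
  then have "1 * (p * D) \<le> 4 * real (Suc r) / \<epsilon> * (p * D)"
    using p assms(1) by (intro mult_right_mono) auto
  then have \<Delta>: "p * D \<le> \<Delta>" by (simp add: \<Delta>_def p_def mult.commute)
  then have "p ^ r * (p * D) \<le> p ^ r * (\<Delta> + K)"
    using p(1) assms(2) by (intro mult_left_mono) simp_all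
  then show "K \<le> (q / M) ^ r * (\<Delta> + K)" using assms(3) by (simp add: p_def mult_ac)
  have "p ^ Suc r * D \<le> p * D"
    using p assms(1) by (intro mult_right_mono) (auto simp: mult_left_le power_le_one)
  then have "K \<le> \<Delta>" using assms(3) \<Delta> by (simp add: p_def)
  then have "\<epsilon>\<^sup>2 / (32 * real (Suc r)) * (\<Delta> + K) * M
      \<le> \<epsilon>\<^sup>2 / (32 * real (Suc r)) * (2 * \<Delta>) * M"
    using assms(4) by (intro mult_right_mono mult_left_mono) auto
  also have "\<dots> = \<epsilon> * D / 4 * q"
    using assms by (simp add: \<Delta>_def field_simps power2_eq_square del: of_nat_Suc)
  finally show "\<epsilon>\<^sup>2 / (32 * real (Suc r)) * (\<Delta> + K) * M \<le> \<epsilon> * D / 4 * q" .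
qed

lemma coverable_shrinking:
  fixes M \<epsilon> :: real
  assumes "bounded_hypergraph V J g (Suc r) D K" "card V \<le> M" "0 < M" "0 < \<epsilon>" "\<epsilon> * D * M \<le> card J"
    and "0 < q" "q \<le> shrink_rate r \<epsilon> * M" "K \<le> (q / M) ^ r * D"
  shows "coverable (omits (shrink_rate r \<epsilon> * M) V) ((card V + 1) ^ (q * r))
    (independent_sets V g J)"
  using assms
proof (induction r arbitrary: J g D \<epsilon>)
  case 0
  then interpret bounded_hypergraph V J g "Suc 0" D K by simp
  show ?case by (rule coverable_singleton_edges) (use 0 in \<open>auto simp: mult_ac\<close>)
next
  case (Suc r)
  define G where "G = shrink_rate (Suc r) \<epsilon> * M"
  define \<epsilon>' where "\<epsilon>' = \<epsilon>\<^sup>2 / (32 * real (Suc r))"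
  define \<Delta> where "\<Delta> = 4 * real (Suc r) * (q / M * D) / \<epsilon>"
  have G: "q \<le> G" "G \<le> \<epsilon> / 4 * M" "G \<le> shrink_rate r \<epsilon>' * M"
    using Suc.prems by (auto simp: G_def \<epsilon>'_def mult_right_mono)
  interpret vertex_scan V J g "Suc r" D K \<Delta> "\<epsilon> * D / 4" G q
    unfolding \<Delta>_def using Suc.prems G by (intro vertex_scan_of_dense) auto
  have "\<epsilon> \<le> 1" using density_le_one Suc.prems by blast
  then have "q \<le> M" using G mult_right_mono[of \<epsilon> 1 M] \<open>0 < M\<close> by linarith
  note shortened = shortened_degree_bounds[OF D_pos K_nonneg Suc.prems(8) \<open>0 < M\<close> \<open>0 < q\<close> \<open>q \<le> M\<close>
      \<open>0 < \<epsilon>\<close> \<open>\<epsilon> \<le> 1\<close>, folded \<Delta>_def \<epsilon>'_def]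
  have "coverable (omits G V) ((card V + 1) ^ (q * r) * (card V + 1) ^ q) (independent_sets V g J)"
  proof (rule coverable_independent_sets)
    fix Q h
    assume Q: "Q \<subseteq> J" and h: "\<And>j. j \<in> Q \<Longrightarrow> h j \<subseteq> g j \<and> card (h j) = Suc r"
      and degree: "\<And>x. degree h Q x \<le> \<Delta> + K" and card_Q: "\<epsilon> * D / 4 * q \<le> card Q"
    have "coverable (omits (shrink_rate r \<epsilon>' * M) V) ((card V + 1) ^ (q * r))
        (independent_sets V h Q)"
    proof (rule Suc.IH)
      show "bounded_hypergraph V Q h (Suc r) (\<Delta> + K) K"
      proof (rule shorten_edges)
        show "h j \<subseteq> g j \<inter> V" "card (h j) = Suc r" if "j \<in> Q" for j
          using h[OF that] edge_subset Q that by auto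
      qed (use Q degree \<Delta>_pos K_nonneg in auto)
      show "\<epsilon>' * (\<Delta> + K) * M \<le> card Q" using shortened(2) card_Q by linarith
    qed (use Suc.prems G shortened(1) in \<open>auto simp: \<epsilon>'_def\<close>)
    then show "coverable (omits G V) ((card V + 1) ^ (q * r)) (independent_sets V h Q)"
      by (rule coverable_mono) (use G in \<open>auto simp: omits_def\<close>)
  qed simp
  then show ?case unfolding G_def mult_Suc_right power_add by (simp only: mult.commute)
qed

theorem hypergraph_containers:
  fixes M \<epsilon> :: real
  assumes "bounded_hypergraph V J g (Suc r) D K" "card V \<le> M" "0 < M" "0 < \<epsilon>"
    and "0 < q" "q \<le> shrink_rate r \<epsilon> * M" "K \<le> (q / M) ^ r * D"
  shows "coverable (\<lambda>C. C \<subseteq> V \<and> card (induced_edges g J C) \<le> \<epsilon> * D * M)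
    ((card V + 1) ^ (q * r * nat \<lceil>1 / shrink_rate r \<epsilon>\<rceil>)) (independent_sets V g J)"
proof -
  interpret bounded_hypergraph V J g "Suc r" D K by fact
  define \<gamma> where "\<gamma> = shrink_rate r \<epsilon>"
  have \<gamma>: "0 < \<gamma>" using assms(4) by (simp add: \<gamma>_def shrink_rate_pos)
  note M = \<open>0 < M\<close>
  have "coverable (\<lambda>C. C \<subseteq> V \<and> card (induced_edges g J C) \<le> \<epsilon> * D * M)
    (((card V + 1) ^ (q * r)) ^ nat \<lceil>1 / \<gamma>\<rceil>) (independent_sets V g J \<inter> Pow V)"
  proof (rule coverable_iterate[where G="\<gamma> * M"])
    have "induced_edges g J {} = {}" using card_edge by (fastforce simp: induced_edges_def)
    then show "card (induced_edges g J {}) \<le> \<epsilon> * D * M" using assms(4) D_pos M by simp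
    have "M = 1 / \<gamma> * (\<gamma> * M)" using \<gamma> by simp
    also have "\<dots> \<le> nat \<lceil>1 / \<gamma>\<rceil> * (\<gamma> * M)"
      using \<gamma> M by (intro mult_right_mono) (auto simp: real_nat_ceiling_ge)
    finally show "card V \<le> nat \<lceil>1 / \<gamma>\<rceil> * (\<gamma> * M)" using assms(2) by linarith
    fix W assume W: "W \<subseteq> V" and many: "\<not> card (induced_edges g J W) \<le> \<epsilon> * D * M"
    have card_W: "card W \<le> card V" using W finite_vertices by (rule card_mono[rotated])
    have "coverable (omits (\<gamma> * M) W) ((card W + 1) ^ (q * r))
        (independent_sets W g (induced_edges g J W))"
      unfolding \<gamma>_def using restrict_vertices[OF W] card_W many assms
      by (intro coverable_shrinking) auto
    then show "coverable (omits (\<gamma> * M) W) ((card V + 1) ^ (q * r))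
        (independent_sets V g J \<inter> Pow W)"
      by (rule coverable_mono)
        (use card_W in \<open>auto simp: independent_sets_def induced_edges_def intro: power_mono\<close>)
  qed (use finite_vertices in auto)
  then show ?thesis
    unfolding \<gamma>_def[symmetric] power_mult[symmetric]
    by (rule coverable_mono) (auto simp: independent_sets_def)
qed

subsection \<open>The hypergraph of coloured copies\<close>

lemma finite_K_edges: "finite (K_edges n)"
  by (rule finite_subset[of _ "Pow {1..n}"]) (auto simp: K_edges_def)

lemma card_K_edges: "card (K_edges n) = n choose 2"
  using n_subsets[of "{1..n}" 2] by (simp add: K_edges_def)

lemma finite_colourings: "finite (colourings k n)"
  by (simp add: colourings_def finite_PiE finite_K_edges)

lemma card_colourings: "card (colourings k n) = k ^ (n choose 2)"
  by (simp add: colourings_def card_PiE finite_K_edges card_K_edges)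

lemma order_embeddings_inj:
  assumes "\<phi> \<in> order_embeddings N n"
  shows "inj_on \<phi> {1..N}" "\<phi> ` {1..N} \<subseteq> {1..n}"
  using assms by (auto simp: order_embeddings_def)

lemma finite_order_embeddings: "finite (order_embeddings N n)"
  by (rule finite_subset[of _ "{1..N} \<rightarrow>\<^sub>E {1..n}"]) (auto simp: order_embeddings_def finite_PiE)

lemma image_K_edges:
  assumes "\<phi> \<in> order_embeddings N n" "e \<in> K_edges N"
  shows "\<phi> ` e \<in> K_edges n"
proof -
  have "card (\<phi> ` e) = card e"
    using assms order_embeddings_inj(1)[OF assms(1)]
    by (intro card_image) (auto simp: K_edges_def intro: inj_on_subset)
  then show ?thesis
    using assms(2) order_embeddings_inj(2)[OF assms(1)] by (auto simp: K_edges_def)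
qed

lemma inj_on_image_K_edges:
  assumes "\<phi> \<in> order_embeddings N n"
  shows "inj_on ((`) \<phi>) (K_edges N)"
  using order_embeddings_inj(1)[OF assms]
  by (intro inj_onI) (auto simp: K_edges_def inj_on_image_eq_iff)

lemma order_embeddings_eqI:
  assumes "\<phi> \<in> order_embeddings N n" "\<psi> \<in> order_embeddings N n" "\<phi> ` {1..N} = \<psi> ` {1..N}"
  shows "\<phi> = \<psi>"
proof -
  have set: "set [1..<Suc N] = {1..N}" by auto
  have "map \<chi> [1..<Suc N] = sorted_list_of_set (\<chi> ` {1..N})" if "\<chi> \<in> order_embeddings N n" for \<chi>
  proof -
    have "sorted (map \<chi> [1..<Suc N])"
      by (rule sorted_map_mono)
        (use that set in \<open>auto simp: order_embeddings_def simp del: upt_Suc\<close>)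
    moreover have "distinct (map \<chi> [1..<Suc N])"
      using that set by (simp add: distinct_map order_embeddings_def del: upt_Suc)
    ultimately show ?thesis
      using set by (metis set_map sorted_list_of_set.idem_if_sorted_distinct)
  qed
  then have "\<phi> i = \<psi> i" if "i \<in> {1..N}" for i
    using assms that set by (metis map_eq_conv)
  then show ?thesis
    using assms by (intro PiE_ext[of \<phi> "{1..N}" "\<lambda>_. {1..n}"]) (auto simp: order_embeddings_def)
qed

lemma card_embeddings_covering_le:
  assumes "finite Y"
  shows "card {\<phi> \<in> order_embeddings N n. Y \<subseteq> \<phi> ` {1..N}} \<le> n ^ (N - card Y)"
proof -
  have "card {\<phi> \<in> order_embeddings N n. Y \<subseteq> \<phi> ` {1..N}}
      \<le> card {W. W \<subseteq> {1..n} \<and> card W = N - card Y}"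
  proof (rule card_inj_on_le[where f="\<lambda>\<phi>. \<phi> ` {1..N} - Y"])
    show "inj_on (\<lambda>\<phi>. \<phi> ` {1..N} - Y) {\<phi> \<in> order_embeddings N n. Y \<subseteq> \<phi> ` {1..N}}"
    proof (rule inj_onI)
      fix \<phi> \<psi>
      assume "\<phi> \<in> {\<phi> \<in> order_embeddings N n. Y \<subseteq> \<phi> ` {1..N}}"
        "\<psi> \<in> {\<phi> \<in> order_embeddings N n. Y \<subseteq> \<phi> ` {1..N}}"
        "\<phi> ` {1..N} - Y = \<psi> ` {1..N} - Y"
      then show "\<phi> = \<psi>" by (intro order_embeddings_eqI) auto
    qed
    show "(\<lambda>\<phi>. \<phi> ` {1..N} - Y) ` {\<phi> \<in> order_embeddings N n. Y \<subseteq> \<phi> ` {1..N}}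
        \<subseteq> {W. W \<subseteq> {1..n} \<and> card W = N - card Y}"
    proof (rule image_subsetI)
      fix \<phi> assume \<phi>: "\<phi> \<in> {\<phi> \<in> order_embeddings N n. Y \<subseteq> \<phi> ` {1..N}}"
      then have "card (\<phi> ` {1..N}) = N" "\<phi> ` {1..N} \<subseteq> {1..n}"
        using order_embeddings_inj[of \<phi> N n] by (simp_all add: card_image)
      then show "\<phi> ` {1..N} - Y \<in> {W. W \<subseteq> {1..n} \<and> card W = N - card Y}"
        using \<phi> assms by (auto simp: card_Diff_subset)
    qed
  qed simp
  also have "\<dots> = n choose (N - card Y)" using n_subsets[of "{1..n}" "N - card Y"] by simp
  also have "\<dots> \<le> n ^ (N - card Y)"
    by (cases "N - card Y \<le> n") (auto simp: binomial_le_pow binomial_eq_0)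
  finally show ?thesis .
qed

lemma card_copies_covering_le:
  assumes "F \<subseteq> colourings k N" "finite Y"
    and "P \<subseteq> {\<phi> \<in> order_embeddings N n. Y \<subseteq> \<phi> ` {1..N}} \<times> F"
  shows "card P \<le> k ^ (N choose 2) * n ^ (N - card Y)"
proof -
  have "card P \<le> card ({\<phi> \<in> order_embeddings N n. Y \<subseteq> \<phi> ` {1..N}} \<times> F)"
    using assms finite_order_embeddings finite_subset[OF assms(1) finite_colourings]
    by (intro card_mono) auto
  also have "\<dots> \<le> n ^ (N - card Y) * k ^ (N choose 2)"
    unfolding card_cartesian_product
    using card_embeddings_covering_le[OF assms(2)] card_mono[OF finite_colourings assms(1)]
    by (intro mult_le_mono) (simp_all add: card_colourings)
  finally show ?thesis by (simp add: mult.commute)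
qed

definition copy_vertices :: "nat \<Rightarrow> (nat \<Rightarrow> nat) \<times> (nat set \<Rightarrow> nat) \<Rightarrow> (nat set \<times> nat) set" where
  "copy_vertices N = (\<lambda>(\<phi>, c). (\<lambda>e. (\<phi> ` e, c e)) ` K_edges N)"

lemma card_copy_vertices:
  assumes "\<phi> \<in> order_embeddings N n"
  shows "card (copy_vertices N (\<phi>, c)) = N choose 2"
proof -
  have "inj_on (\<lambda>e. (\<phi> ` e, c e)) (K_edges N)"
    using inj_on_image_K_edges[OF assms] by (auto simp: inj_on_def)
  then show ?thesis by (simp add: copy_vertices_def card_image card_K_edges)
qed

lemma copy_vertices_subset:
  assumes "\<phi> \<in> order_embeddings N n" "c \<in> colourings k N"
  shows "copy_vertices N (\<phi>, c) \<subseteq> K_edges n \<times> {1..k}"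
  using image_K_edges[OF assms(1)] assms(2) by (auto simp: copy_vertices_def colourings_def)

lemma copy_vertices_fst:
  assumes "\<phi> \<in> order_embeddings N n" "x \<in> copy_vertices N (\<phi>, c)"
  shows "fst x \<subseteq> \<phi> ` {1..N}" "card (fst x) = 2" "finite (fst x)"
proof -
  obtain e where "e \<in> K_edges N" "fst x = \<phi> ` e" using assms(2) by (auto simp: copy_vertices_def)
  then show "fst x \<subseteq> \<phi> ` {1..N}" "card (fst x) = 2"
    using image_K_edges[OF assms(1)] by (auto simp: K_edges_def)
  then show "finite (fst x)" using finite_subset by blast
qed

lemma copies_through_vertex_subset:
  "{p \<in> order_embeddings N n \<times> F. x \<in> copy_vertices N p}
    \<subseteq> {\<phi> \<in> order_embeddings N n. fst x \<subseteq> \<phi> ` {1..N}} \<times> F"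
proof
  fix p assume p: "p \<in> {p \<in> order_embeddings N n \<times> F. x \<in> copy_vertices N p}"
  then have "fst x \<subseteq> fst p ` {1..N}" by (intro copy_vertices_fst(1)[of _ N n x "snd p"]) auto
  then show "p \<in> {\<phi> \<in> order_embeddings N n. fst x \<subseteq> \<phi> ` {1..N}} \<times> F"
    using p by (auto simp: mem_Times_iff)
qed

lemma card_fst_Un_copy_vertices:
  assumes \<phi>: "\<phi> \<in> order_embeddings N n"
    and x: "x \<in> copy_vertices N (\<phi>, c)" and y: "y \<in> copy_vertices N (\<phi>, c)" and "x \<noteq> y"
  shows "3 \<le> card (fst x \<union> fst y)"
proof -
  note fst_x = copy_vertices_fst[OF \<phi> x] and fst_y = copy_vertices_fst[OF \<phi> y]
  obtain e e' where e: "e \<in> K_edges N" "x = (\<phi> ` e, c e)"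
    and e': "e' \<in> K_edges N" "y = (\<phi> ` e', c e')"
    using x y by (auto simp: copy_vertices_def)
  then have "fst x \<noteq> fst y"
    using \<open>x \<noteq> y\<close> inj_onD[OF inj_on_image_K_edges[OF \<phi>], of e e'] by auto
  then have "fst x \<subset> fst x \<union> fst y"
    using fst_x(2,3) fst_y(2,3) by (metis card_subset_eq psubsetI sup.cobounded1 sup.cobounded2)
  then show ?thesis
    using fst_x(2,3) fst_y(3) psubset_card_mono[of "fst x \<union> fst y" "fst x"] by simp
qed

lemma degree_copies_le:
  assumes "F \<subseteq> colourings k N"
  shows "degree (copy_vertices N) (order_embeddings N n \<times> F) x \<le> k ^ (N choose 2) * n ^ (N - 2)"
proof -
  let ?P = "{p \<in> order_embeddings N n \<times> F. x \<in> copy_vertices N p}"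
  show ?thesis
  proof (cases "?P = {}")
    case True
    then show ?thesis unfolding degree_def by (simp only: card.empty)
  next
    case False
    then obtain \<phi> c where "\<phi> \<in> order_embeddings N n" "x \<in> copy_vertices N (\<phi>, c)" by auto
    then have x: "card (fst x) = 2" "finite (fst x)" by (rule copy_vertices_fst)+
    show ?thesis
      unfolding degree_def
      using card_copies_covering_le[OF assms x(2) copies_through_vertex_subset] by (simp only: x(1))
  qed
qed

lemma codegree_copies_le:
  assumes "F \<subseteq> colourings k N" "1 \<le> n" "x \<noteq> y"
  shows "codegree (copy_vertices N) (order_embeddings N n \<times> F) x y * n
    \<le> k ^ (N choose 2) * n ^ (N - 2)"
proof -
  let ?P = "{p \<in> order_embeddings N n \<times> F. x \<in> copy_vertices N p \<and> y \<in> copy_vertices N p}"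
  let ?Y = "fst x \<union> fst y"
  show ?thesis
  proof (cases "?P = {}")
    case True
    then show ?thesis unfolding codegree_def by (simp only: card.empty)
  next
    case False
    then obtain \<phi> c where \<phi>: "\<phi> \<in> order_embeddings N n"
      and x: "x \<in> copy_vertices N (\<phi>, c)" and y: "y \<in> copy_vertices N (\<phi>, c)" by auto
    have Y: "3 \<le> card ?Y" "finite ?Y" "?Y \<subseteq> \<phi> ` {1..N}"
      using card_fst_Un_copy_vertices[OF \<phi> x y assms(3)]
        copy_vertices_fst[OF \<phi> x] copy_vertices_fst[OF \<phi> y] by auto
    have "card ?Y \<le> N"
      using card_mono[OF _ Y(3)] card_image[OF order_embeddings_inj(1)[OF \<phi>]] by simp
    then have "N - card ?Y + 1 \<le> N - 2" using Y(1) by linarith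
    have "?P \<subseteq> {\<phi> \<in> order_embeddings N n. ?Y \<subseteq> \<phi> ` {1..N}} \<times> F"
      using copies_through_vertex_subset[of N n F x] copies_through_vertex_subset[of N n F y]
      by blast
    then have "card ?P * n \<le> k ^ (N choose 2) * n ^ (N - card ?Y + 1)"
      using card_copies_covering_le[OF assms(1) Y(2)] by simp
    also have "\<dots> \<le> k ^ (N choose 2) * n ^ (N - 2)"
      using \<open>N - card ?Y + 1 \<le> N - 2\<close> assms(2) by (intro mult_le_mono2 power_increasing)
    finally show ?thesis by (simp add: codegree_def)
  qed
qed

lemma bounded_hypergraph_copies:
  assumes "1 \<le> k" "1 \<le> n" "F \<subseteq> colourings k N"
  defines "D \<equiv> real k ^ (N choose 2) * real n ^ (N - 2)"
  shows "bounded_hypergraph (K_edges n \<times> {1..k}) (order_embeddings N n \<times> F) (copy_vertices N)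
    (N choose 2) D (D / n)"
proof
  have D: "D = real (k ^ (N choose 2) * n ^ (N - 2))" by (simp add: D_def)
  show "degree (copy_vertices N) (order_embeddings N n \<times> F) x \<le> D" for x
    unfolding D of_nat_le_iff using assms(3) by (rule degree_copies_le)
  show "codegree (copy_vertices N) (order_embeddings N n \<times> F) x y \<le> D / n" if "x \<noteq> y" for x y
  proof -
    have "codegree (copy_vertices N) (order_embeddings N n \<times> F) x y * real n \<le> D"
      unfolding D of_nat_mult[symmetric] of_nat_le_iff
      using codegree_copies_le[OF assms(3,2) that] .
    then show ?thesis using assms(2) by (simp add: field_simps)
  qed
  show "copy_vertices N p \<subseteq> K_edges n \<times> {1..k}" "card (copy_vertices N p) = N choose 2"
    if "p \<in> order_embeddings N n \<times> F" for p
    using that assms(3) copy_vertices_subset card_copy_vertices by (fastforce simp: mem_Times_iff)+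
  show "finite (order_embeddings N n \<times> F)"
    using finite_order_embeddings finite_subset[OF assms(3) finite_colourings] by simp
qed (use assms finite_K_edges in \<open>auto simp: D_def\<close>)

subsection \<open>Templates as independent sets\<close>

lemma realisations_eq_PiE:
  assumes "t \<in> templates k n"
  shows "realisations k n t = Pi\<^sub>E (K_edges n) t"
proof -
  have "\<forall>e\<in>K_edges n. t e \<subseteq> {1..k}" using assms by (auto simp: templates_def PiE_iff)
  then show ?thesis by (auto simp: realisations_def colourings_def PiE_def Pi_def subset_iff)
qed

lemma realisations_nonempty:
  assumes "t \<in> templates k n"
  shows "realisations k n t \<noteq> {}"
  unfolding realisations_eq_PiE[OF assms] PiE_eq_empty_iff
  using assms by (auto simp: templates_def PiE_iff)

lemma realisations_restr_iff:
  assumes "\<phi> \<in> order_embeddings N n" "c \<in> colourings k N"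
  shows "c \<in> realisations k N (restr N t \<phi>) \<longleftrightarrow> copy_vertices N (\<phi>, c) \<subseteq> Sigma (K_edges n) t"
  using assms image_K_edges[OF assms(1)]
  by (auto simp: realisations_def restr_def copy_vertices_def)

lemma realisation_extends:
  assumes t: "t \<in> templates k n" and \<phi>: "\<phi> \<in> order_embeddings N n"
    and c: "c \<in> realisations k N (restr N t \<phi>)"
  shows "\<exists>c'\<in>realisations k n t. restr N c' \<phi> = c"
proof -
  obtain d where d: "d \<in> Pi\<^sub>E (K_edges n) t"
    using realisations_nonempty[OF t] realisations_eq_PiE[OF t] by blast
  define pre where "pre = inv_into (K_edges N) ((`) \<phi>)"
  define c' where "c' = (\<lambda>e\<in>K_edges n. if e \<in> (`) \<phi> ` K_edges N then c (pre e) else d e)"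
  have pre: "pre (\<phi> ` e) = e" if "e \<in> K_edges N" for e
    unfolding pre_def using inj_on_image_K_edges[OF \<phi>] that by (rule inv_into_f_f)
  have "c' \<in> Pi\<^sub>E (K_edges n) t"
    using c d pre by (auto simp: c'_def realisations_def restr_def)
  moreover have "restr N c' \<phi> = c"
  proof (rule extensionalityI[of _ "K_edges N"])
    show "c \<in> extensional (K_edges N)"
      using c by (auto simp: realisations_def colourings_def PiE_def)
    show "restr N c' \<phi> e = c e" if "e \<in> K_edges N" for e
      using that pre image_K_edges[OF \<phi>] by (simp add: restr_def c'_def)
  qed (simp add: restr_def)
  ultimately show ?thesis using realisations_eq_PiE[OF t] by blast
qed

lemma Sigma_template_independent:
  assumes t: "t \<in> templates k n" and forb: "realisations k n t \<subseteq> Forb k N F n"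
    and F: "F \<subseteq> colourings k N"
  shows "Sigma (K_edges n) t
    \<in> independent_sets (K_edges n \<times> {1..k}) (copy_vertices N) (order_embeddings N n \<times> F)"
proof -
  have "\<not> copy_vertices N (\<phi>, c) \<subseteq> Sigma (K_edges n) t"
    if \<phi>: "\<phi> \<in> order_embeddings N n" and c: "c \<in> F" for \<phi> c
  proof
    assume "copy_vertices N (\<phi>, c) \<subseteq> Sigma (K_edges n) t"
    then have "c \<in> realisations k N (restr N t \<phi>)"
      using realisations_restr_iff[OF \<phi>] c F by blast
    then obtain c' where "c' \<in> realisations k n t" "restr N c' \<phi> = c"
      using realisation_extends[OF t \<phi>] by blast
    then show False using forb \<phi> c by (auto simp: Forb_def)
  qed
  then show ?thesis
    using t by (auto simp: independent_sets_def induced_edges_def templates_def PiE_iff)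
qed

definition template_of :: "nat \<Rightarrow> (nat set \<times> nat) set \<Rightarrow> nat set \<Rightarrow> nat set" where
  "template_of n C = (\<lambda>e\<in>K_edges n. C `` {e})"

lemma template_of_templates:
  assumes "t \<in> templates k n" "Sigma (K_edges n) t \<subseteq> C" "C \<subseteq> K_edges n \<times> {1..k}"
  shows "template_of n C \<in> templates k n"
  using assms unfolding templates_def template_of_def by (fastforce simp: PiE_iff)

definition realised_copies ::
  "nat \<Rightarrow> nat \<Rightarrow> (nat set \<Rightarrow> nat) set \<Rightarrow> nat \<Rightarrow> (nat set \<Rightarrow> nat set) \<Rightarrow>
    ((nat \<Rightarrow> nat) \<times> (nat set \<Rightarrow> nat)) set"
  where "realised_copies k N F n t =
    {(\<phi>, c). \<phi> \<in> order_embeddings N n \<and> c \<in> F \<and> c \<in> realisations k N (restr N t \<phi>)}"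

lemma realised_copies_template_of:
  assumes "F \<subseteq> colourings k N"
  shows "realised_copies k N F n (template_of n C)
    \<subseteq> induced_edges (copy_vertices N) (order_embeddings N n \<times> F) C"
proof -
  have "Sigma (K_edges n) (template_of n C) \<subseteq> C" by (auto simp: template_of_def)
  then show ?thesis
    using realisations_restr_iff[of _ N n] assms
    by (fastforce simp: realised_copies_def induced_edges_def)
qed

lemma container_family_template_of:
  assumes F: "F \<subseteq> colourings k N"
    and vertices: "\<And>C. C \<in> \<C> \<Longrightarrow> C \<subseteq> K_edges n \<times> {1..k}"
    and covers: "\<And>I. I \<in> independent_sets (K_edges n \<times> {1..k}) (copy_vertices N)
      (order_embeddings N n \<times> F) \<Longrightarrow> \<exists>C\<in>\<C>. I \<subseteq> C"
  shows "container_family k n (Forb k N F n) (templates k n \<inter> template_of n ` \<C>)"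
  unfolding container_family_def
proof (intro ballI impI)
  fix t assume t: "t \<in> templates k n" and forb: "realisations k n t \<subseteq> Forb k N F n"
  obtain C where C: "C \<in> \<C>" "Sigma (K_edges n) t \<subseteq> C"
    using covers[OF Sigma_template_independent[OF t forb F]] by blast
  then have "template_of n C \<in> templates k n"
    using template_of_templates[OF t] vertices by blast
  moreover have "\<forall>e\<in>K_edges n. t e \<subseteq> template_of n C e"
    using C(2) by (auto simp: template_of_def)
  ultimately show "\<exists>t'\<in>templates k n \<inter> template_of n ` \<C>. \<forall>e\<in>K_edges n. t e \<subseteq> t' e"
    using C(1) by blast
qed

lemma template_containers_of_coverable:
  fixes b :: real
  assumes F: "F \<subseteq> colourings k N"
    and cover: "coverable (\<lambda>C. C \<subseteq> K_edges n \<times> {1..k} \<and>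
        card (induced_edges (copy_vertices N) (order_embeddings N n \<times> F) C) \<le> b) m
      (independent_sets (K_edges n \<times> {1..k}) (copy_vertices N) (order_embeddings N n \<times> F))"
  shows "\<exists>T. T \<subseteq> templates k n \<and> container_family k n (Forb k N F n) T \<and>
    (\<forall>t\<in>T. card (realised_copies k N F n t) \<le> b) \<and> card T \<le> m"
proof -
  let ?copies = "induced_edges (copy_vertices N) (order_embeddings N n \<times> F)"
  from cover obtain \<C> where finite: "finite \<C>" and card: "card \<C> \<le> m"
    and few: "\<And>C. C \<in> \<C> \<Longrightarrow> C \<subseteq> K_edges n \<times> {1..k} \<and> card (?copies C) \<le> b"
    and covers: "\<And>I. I \<in> independent_sets (K_edges n \<times> {1..k}) (copy_vertices N)
      (order_embeddings N n \<times> F) \<Longrightarrow> \<exists>C\<in>\<C>. I \<subseteq> C"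
    by (rule coverableE) blast
  show ?thesis
  proof (intro exI[of _ "templates k n \<inter> template_of n ` \<C>"] conjI ballI)
    show "container_family k n (Forb k N F n) (templates k n \<inter> template_of n ` \<C>)"
      using F few covers by (intro container_family_template_of) blast+
    have "card (templates k n \<inter> template_of n ` \<C>) \<le> card (template_of n ` \<C>)"
      using finite by (intro card_mono) auto
    also have "\<dots> \<le> card \<C>" using finite by (rule card_image_le)
    finally show "card (templates k n \<inter> template_of n ` \<C>) \<le> m" using card by linarith
    fix t assume "t \<in> templates k n \<inter> template_of n ` \<C>"
    then obtain C where C: "C \<in> \<C>" "t = template_of n C" by blast
    have "finite (?copies C)"
      using finite_order_embeddings finite_subset[OF F finite_colourings]
      by (simp add: induced_edges_def)
    then have "card (realised_copies k N F n t) \<le> card (?copies C)"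
      unfolding C(2) using realised_copies_template_of[OF F] by (rule card_mono)
    then show "card (realised_copies k N F n t) \<le> b" using few[OF C(1)] by linarith
  qed simp
qed

subsection \<open>Choice of parameters\<close>

definition selection_budget :: "nat \<Rightarrow> nat \<Rightarrow> real \<Rightarrow> nat" where
  "selection_budget r n M = nat \<lceil>M * n powr (- 1 / Suc r)\<rceil>"

lemma selection_budget_bounds:
  fixes M :: real
  assumes "1 \<le> n" "n \<le> M"
  shows "0 < selection_budget r n M" "M * n powr (- 1 / Suc r) \<le> selection_budget r n M"
    "selection_budget r n M \<le> 2 * (M * n powr (- 1 / Suc r))"
proof -
  have "n powr (- 1) \<le> n powr (- 1 / Suc r)"
    using assms(1) by (intro powr_mono) (auto simp: field_simps)
  then have "1 \<le> n * n powr (- 1 / Suc r)"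
    using assms(1) by (simp add: powr_minus_divide field_simps)
  also have "\<dots> \<le> M * n powr (- 1 / Suc r)" using assms(2) by (intro mult_right_mono) auto
  finally have "1 \<le> M * n powr (- 1 / Suc r)" .
  then show "0 < selection_budget r n M" "M * n powr (- 1 / Suc r) \<le> selection_budget r n M"
    "selection_budget r n M \<le> 2 * (M * n powr (- 1 / Suc r))"
    unfolding selection_budget_def by linarith+
qed

lemma selection_budget_admissible:
  fixes M D \<gamma> :: real
  assumes n: "1 \<le> n" "n \<le> M" and D: "0 < D" and \<gamma>: "0 < \<gamma>" "(2 / \<gamma>) ^ Suc r \<le> n"
  shows "selection_budget r n M \<le> \<gamma> * M" "D / n \<le> (selection_budget r n M / M) ^ r * D"
proof -
  define x where "x = n powr (- 1 / Suc r)"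
  note budget = selection_budget_bounds[OF n, of r, folded x_def]
  have M: "0 < M" using n by linarith
  have "x \<le> n powr 0" unfolding x_def using n(1) by (intro powr_mono) auto
  then have x: "0 < x" "x \<le> 1" using n(1) by (simp_all add: x_def)
  have "x ^ Suc r = x powr Suc r" using x(1) by (simp only: powr_realpow)
  also have "\<dots> = n powr (- 1)" unfolding x_def powr_powr by simp
  also have "\<dots> = 1 / n" using n(1) by (simp add: powr_minus_divide)
  finally have x_power: "x ^ Suc r = 1 / n" .
  have "(2 / \<gamma>) ^ Suc r * x ^ Suc r \<le> 1"
    unfolding x_power using \<gamma>(2) n(1) by (simp add: divide_le_eq_1 del: power_Suc)
  then have "(2 / \<gamma> * x) ^ Suc r \<le> 1 ^ Suc r" by (simp only: power_mult_distrib power_one)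
  then have "2 / \<gamma> * x \<le> 1" by (rule power_le_imp_le_base) simp
  then have "2 * x * M \<le> \<gamma> * M" using \<gamma>(1) M by (simp add: field_simps)
  then show "selection_budget r n M \<le> \<gamma> * M" using budget(3) by (simp add: mult_ac)
  have "1 / n \<le> x ^ r" unfolding x_power[symmetric] using x by (intro power_decreasing) auto
  also have "\<dots> \<le> (selection_budget r n M / M) ^ r"
    using budget(2) x M by (intro power_mono) (auto simp: field_simps)
  finally show "D / n \<le> (selection_budget r n M / M) ^ r * D"
    using D mult_right_mono[of "1 / n" _ D] by fastforce
qed

lemma le_mult_square:
  fixes k n :: nat
  assumes "1 \<le> k"
  shows "n \<le> k * n ^ 2"
proof -
  have "n * 1 \<le> n * (k * n)" using assms by (cases "n = 0") (auto intro!: mult_le_mono2)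
  then show ?thesis by (simp add: power2_eq_square mult_ac)
qed

definition copy_density :: "real \<Rightarrow> nat \<Rightarrow> nat \<Rightarrow> real" where
  "copy_density \<epsilon> k N = \<epsilon> / (real k ^ (N choose 2) * k * real N ^ N)"

lemma copy_density_le_binomial:
  fixes \<epsilon> :: real
  assumes "0 < \<epsilon>" "1 \<le> k" "2 \<le> N" "N \<le> n"
  shows "copy_density \<epsilon> k N * (real k ^ (N choose 2) * real n ^ (N - 2)) * (k * real n ^ 2)
    \<le> \<epsilon> * (n choose N)"
proof -
  have "real n ^ (N - 2) * real n ^ 2 = real n ^ N"
    using assms(3) by (metis le_add_diff_inverse2 power_add)
  then have "copy_density \<epsilon> k N * (real k ^ (N choose 2) * real n ^ (N - 2)) * (k * real n ^ 2)
      = \<epsilon> * (real n / real N) ^ N"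
    using assms by (simp add: copy_density_def power_divide field_simps)
  also have "\<dots> \<le> \<epsilon> * (n choose N)"
    using assms binomial_ge_n_over_k_pow_k[of N n, where 'a=real] by (intro mult_left_mono) auto
  finally show ?thesis .
qed

definition container_bound :: "nat \<Rightarrow> nat \<Rightarrow> real \<Rightarrow> nat \<Rightarrow> nat" where
  "container_bound k r \<eta> n =
    (k * n ^ 2 + 1) ^ (selection_budget r n (real (k * n ^ 2)) * r * nat \<lceil>1 / shrink_rate r \<eta>\<rceil>)"

lemma Forb_containers:
  fixes \<epsilon> :: real
  assumes k: "1 \<le> k" and r: "N choose 2 = Suc r" and N: "2 \<le> N" "N \<le> n" and \<epsilon>: "0 < \<epsilon>"
    and n: "(2 / shrink_rate r (copy_density \<epsilon> k N)) ^ Suc r \<le> n" and F: "F \<subseteq> colourings k N"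
  shows "\<exists>T. T \<subseteq> templates k n \<and> container_family k n (Forb k N F n) T \<and>
    (\<forall>t\<in>T. card (realised_copies k N F n t) \<le> \<epsilon> * (n choose N)) \<and>
    card T \<le> container_bound k r (copy_density \<epsilon> k N) n"
proof -
  let ?V = "K_edges n \<times> {1..k}" and ?J = "order_embeddings N n \<times> F"
  define \<eta> where "\<eta> = copy_density \<epsilon> k N"
  define M where "M = real (k * n ^ 2)"
  define D where "D = real k ^ (N choose 2) * real n ^ (N - 2)"
  define b where "b = selection_budget r n M * r * nat \<lceil>1 / shrink_rate r \<eta>\<rceil>"
  have \<eta>: "0 < \<eta>" using \<epsilon> k N by (simp add: \<eta>_def copy_density_def)
  have n1: "1 \<le> n" and D: "0 < D" using k N by (simp_all add: D_def)
  have nM: "n \<le> M" unfolding M_def of_nat_le_iff using k by (rule le_mult_square)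
  have "n choose 2 \<le> n ^ 2" using N by (intro binomial_le_pow) simp
  then have card_V: "card ?V \<le> k * n ^ 2" by (simp add: card_cartesian_product card_K_edges)
  have "coverable (\<lambda>C. C \<subseteq> ?V \<and> card (induced_edges (copy_vertices N) ?J C) \<le> \<eta> * D * M)
      ((card ?V + 1) ^ b) (independent_sets ?V (copy_vertices N) ?J)"
    unfolding b_def
  proof (rule hypergraph_containers)
    show "bounded_hypergraph ?V ?J (copy_vertices N) (Suc r) D (D / n)"
      unfolding D_def r[symmetric] using k n1 F by (rule bounded_hypergraph_copies)
    show "card ?V \<le> M" unfolding M_def of_nat_le_iff by (fact card_V)
    show "0 < selection_budget r n M" using n1 nM by (rule selection_budget_bounds)
    show "selection_budget r n M \<le> shrink_rate r \<eta> * M"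
      "D / n \<le> (selection_budget r n M / M) ^ r * D"
      using n n1 nM D shrink_rate_pos[OF \<eta>] by (intro selection_budget_admissible; simp add: \<eta>_def)+
  qed (use k n1 \<eta> in \<open>simp_all add: M_def\<close>)
  then have "coverable (\<lambda>C. C \<subseteq> ?V \<and> card (induced_edges (copy_vertices N) ?J C) \<le> \<epsilon> * (n choose N))
      ((k * n ^ 2 + 1) ^ b) (independent_sets ?V (copy_vertices N) ?J)"
    using copy_density_le_binomial[OF \<epsilon> k N] card_V
    by (elim coverable_mono) (auto simp: \<eta>_def D_def M_def intro: power_mono)
  from template_containers_of_coverable[OF F this] show ?thesis
    by (simp add: container_bound_def b_def M_def \<eta>_def)
qed

lemma ln_quadratic_le_powr:
  fixes c x \<delta> :: real
  assumes "0 \<le> c" "1 \<le> x" "0 < \<delta>"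
  shows "ln (c * x\<^sup>2 + 1) \<le> (ln (c + 1) + 2 / \<delta>) * x powr \<delta>"
proof -
  have "ln (c * x\<^sup>2 + 1) \<le> ln ((c + 1) * x\<^sup>2)"
    using assms by (subst ln_le_cancel_iff) (auto simp: algebra_simps add_pos_nonneg)
  also have "\<dots> = ln (c + 1) + 2 * ln x"
    using assms by (simp add: ln_mult ln_realpow)
  also have "\<dots> \<le> ln (c + 1) * x powr \<delta> + 2 * (x powr \<delta> / \<delta>)"
    using assms ln_powr_bound[of x \<delta>] mult_left_mono[of 1 "x powr \<delta>" "ln (c + 1)"]
    by (simp add: ge_one_powr_ge_zero)
  finally show ?thesis by (simp add: algebra_simps)
qed

lemma square_le_choose_two:
  assumes "2 \<le> n"
  shows "real n ^ 2 \<le> 4 * (n choose 2)"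
proof -
  have "real (n choose 2) = real n * (real n - 1) / 2"
    using assms by (simp add: choose_two real_of_nat_div of_nat_diff)
  moreover have "real n * 2 \<le> real n * n" using assms by (intro mult_left_mono) auto
  ultimately show ?thesis by (simp add: power2_eq_square algebra_simps)
qed

text \<open>Both \<open>log k 0\<close> and \<open>log 1 x\<close> take the junk value \<open>0\<close>.\<close>

lemma log_of_nat_mono:
  fixes k a b :: nat
  assumes "1 \<le> k" "a \<le> b" "1 \<le> b"
  shows "log k a \<le> log k b"
  using assms unfolding log_def by (cases "a = 0") (auto intro: divide_right_mono)

lemma selection_budget_mult_ln_le:
  fixes \<alpha> \<delta> :: real
  assumes k: "1 \<le> k" and n: "2 \<le> n" and \<delta>: "0 < \<delta>" "1 / Suc r = \<alpha> + \<delta>"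
  shows "selection_budget r n (real (k * n ^ 2)) * ln (k * real n ^ 2 + 1)
    \<le> 8 * k * (ln (real k + 1) + 2 / \<delta>) * ((n choose 2) / n powr \<alpha>)"
proof -
  define B where "B = ln (real k + 1) + 2 / \<delta>"
  have B: "0 \<le> B" using \<delta>(1) by (simp add: B_def)
  have "real n \<le> real (k * n ^ 2)" using le_mult_square[OF k] by (simp only: of_nat_le_iff)
  then have budget: "selection_budget r n (real (k * n ^ 2))
      \<le> 2 * (k * real n ^ 2 * n powr (- 1 / Suc r))"
    using selection_budget_bounds(3)[of n "real (k * n ^ 2)" r] n by simp
  have "selection_budget r n (real (k * n ^ 2)) * ln (k * real n ^ 2 + 1)
      \<le> 2 * (k * real n ^ 2 * n powr (- 1 / Suc r)) * (B * n powr \<delta>)"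
    unfolding B_def using budget ln_quadratic_le_powr[of k n \<delta>] n \<delta>(1) by (intro mult_mono) auto
  also have "\<dots> = 2 * k * B * (n powr (- 1 / Suc r) * n powr \<delta>) * real n ^ 2"
    by (simp add: mult_ac)
  also have "n powr (- 1 / Suc r) * n powr \<delta> = 1 / n powr \<alpha>"
    using \<delta>(2) by (simp add: powr_add[symmetric] powr_minus_divide[symmetric] del: of_nat_Suc)
  also have "2 * k * B * (1 / n powr \<alpha>) * real n ^ 2
      \<le> 2 * k * B * (1 / n powr \<alpha>) * (4 * (n choose 2))"
    using square_le_choose_two[OF n] B by (intro mult_left_mono) auto
  finally show ?thesis by (simp add: B_def)
qed

lemma log_container_bound_le:
  assumes k: "1 \<le> k"
  shows "\<exists>C>0. \<forall>n\<ge>2. \<forall>a\<le>container_bound k r \<eta> n.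
    log k a \<le> C / n powr (1 / (2 * real (Suc r) - 1)) * (n choose 2)"
proof -
  define \<alpha> where "\<alpha> = 1 / (2 * real (Suc r) - 1)"
  define \<delta> where "\<delta> = 1 / Suc r - \<alpha>"
  define m where "m = nat \<lceil>1 / shrink_rate r \<eta>\<rceil>"
  define A where "A = r * m / ln k"
  define B where "B = 8 * real k * (ln (real k + 1) + 2 / \<delta>)"
  have A: "0 \<le> A" using k by (simp add: A_def)
  have \<delta>: "0 < \<delta>" if "r \<noteq> 0"
    using that by (auto simp: \<delta>_def \<alpha>_def field_simps intro!: divide_pos_pos add_pos_nonneg)
  have AB: "0 \<le> A * B"
  proof (cases "r = 0")
    case False
    then have "0 \<le> B" using \<delta> by (simp add: B_def)
    then show ?thesis using A by (rule mult_nonneg_nonneg[rotated])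
  qed (simp add: A_def)
  have "log k a \<le> (A * B + 1) / n powr \<alpha> * (n choose 2)"
    if n: "2 \<le> n" and a: "a \<le> container_bound k r \<eta> n" for n a
  proof -
    have "log k a \<le> log k (container_bound k r \<eta> n)"
      using k a by (intro log_of_nat_mono) (auto simp: container_bound_def)
    also have "\<dots> = A * (selection_budget r n (real (k * n ^ 2)) * ln (k * real n ^ 2 + 1))"
      by (simp add: container_bound_def A_def m_def log_def ln_realpow add_nonneg_pos add.commute)
    also have "\<dots> \<le> A * (B * ((n choose 2) / n powr \<alpha>))"
    proof (cases "r = 0")
      case False
      have "1 / Suc r = \<alpha> + \<delta>" by (simp add: \<delta>_def)
      from selection_budget_mult_ln_le[OF k n \<delta>[OF False] this]
      show ?thesis unfolding B_def using A by (rule mult_left_mono)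
    qed (simp add: A_def)
    also have "\<dots> \<le> (A * B + 1) / n powr \<alpha> * (n choose 2)"
      by (auto simp: field_simps intro!: divide_right_mono)
    finally show ?thesis .
  qed
  then show ?thesis using AB unfolding \<alpha>_def by (intro exI[of _ "A * B + 1"]) auto
qed

lemma container_family_degenerate:
  assumes F: "F \<subseteq> colourings k N" "F \<noteq> {}" and small: "N \<le> 1 \<or> k = 0" and n: "1 \<le> n"
  shows "container_family k n (Forb k N F n) {}"
proof -
  have N: "N \<le> 1"
  proof (rule ccontr)
    assume "\<not> N \<le> 1"
    then have "k = 0" "{1, 2} \<in> K_edges N" using small by (auto simp: K_edges_def)
    then have "colourings k N = {}" unfolding colourings_def by (auto simp: PiE_eq_empty_iff)
    then show False using F by simp
  qed
  then have K: "K_edges N = {}"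
    using card_K_edges[of N] finite_K_edges[of N] by (simp add: binomial_eq_0)
  then have "F = {\<lambda>_. undefined}" using F by (auto simp: colourings_def)
  then have "restr N c \<phi> \<in> F" for c \<phi> using K by (auto simp: restr_def)
  moreover have "restrict (\<lambda>i. i) {1..N} \<in> order_embeddings N n"
    using N n by (auto simp: order_embeddings_def mono_on_def inj_on_def)
  ultimately have "Forb k N F n = {}" by (auto simp: Forb_def)
  then show ?thesis using realisations_nonempty by (auto simp: container_family_def)
qed

theorem theorem2p6:
  fixes k N :: nat and \<epsilon> :: real
  assumes "\<epsilon> > 0"
  shows "\<exists>(C\<^sub>0::real) (n\<^sub>0::nat). C\<^sub>0 > 0 \<and> n\<^sub>0 > 0 \<and>
    (\<forall>F. F \<subseteq> colourings k N \<and> F \<noteq> {} \<longrightarrow>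
      (\<forall>n\<ge>n\<^sub>0. \<exists>T. T \<subseteq> templates k n \<and>
         container_family k n (Forb k N F n) T \<and>
         (\<forall>t\<in>T. real (card {(\<phi>, c). \<phi> \<in> order_embeddings N n \<and> c \<in> F \<and>
                                c \<in> realisations k N (restr N t \<phi>)})
                  \<le> \<epsilon> * real (n choose N)) \<and>
         log (real k) (real (card T))
           \<le> C\<^sub>0 / (real n powr (1 / (2 * real (N choose 2) - 1))) * real (n choose 2)))"
proof (cases "N \<le> 1 \<or> k = 0")
  case True
  then show ?thesis
    by (intro exI[of _ 1] conjI allI impI exI[of _ "{}"])
      (auto simp: log_def intro: container_family_degenerate)
next
  case False
  then have k: "1 \<le> k" and N: "2 \<le> N" by auto
  then obtain r where r: "N choose 2 = Suc r" using gr0_implies_Suc[of "N choose 2"] by auto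
  define \<eta> where "\<eta> = copy_density \<epsilon> k N"
  obtain C\<^sub>0 where C\<^sub>0: "0 < C\<^sub>0" and count: "\<And>n a. 2 \<le> n \<Longrightarrow> a \<le> container_bound k r \<eta> n \<Longrightarrow>
      log k a \<le> C\<^sub>0 / n powr (1 / (2 * real (N choose 2) - 1)) * (n choose 2)"
    using log_container_bound_le[OF k] unfolding r by metis
  define n\<^sub>0 where "n\<^sub>0 = max N (nat \<lceil>(2 / shrink_rate r \<eta>) ^ Suc r\<rceil>)"
  show ?thesis
    unfolding realised_copies_def[symmetric]
  proof (intro exI[of _ C\<^sub>0] exI[of _ n\<^sub>0] conjI allI impI)
    fix F n assume "F \<subseteq> colourings k N \<and> F \<noteq> {}" and "n\<^sub>0 \<le> n"
    then have F: "F \<subseteq> colourings k N" and n: "N \<le> n" "(2 / shrink_rate r \<eta>) ^ Suc r \<le> n"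
      by (simp_all add: n\<^sub>0_def ceiling_le_iff nat_le_iff del: power_Suc)
    from Forb_containers[OF k r N n(1) assms n(2)[unfolded \<eta>_def] F, folded \<eta>_def]
    show "\<exists>T. T \<subseteq> templates k n \<and> container_family k n (Forb k N F n) T \<and>
        (\<forall>t\<in>T. card (realised_copies k N F n t) \<le> \<epsilon> * (n choose N)) \<and>
        log k (card T) \<le> C\<^sub>0 / n powr (1 / (2 * real (N choose 2) - 1)) * (n choose 2)"
      by (rule ex_forward) (use count N n(1) in auto)
  qed (use C\<^sub>0 N in \<open>simp_all add: n\<^sub>0_def less_max_iff_disj\<close>)
qed

end
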